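(* Consider the following linear program (a convex relaxation of the sample average approximation integer program described in the context, with $w=0$): $$\min_{x,\,u^1,\dots,u^K}\; c_x^Tx+\frac1K\sum_{k=1}^K\sum_{ijt}u^k_{ijt}$$ subject to $$\sum_{j=1}^n\bigl(x_{ijt}-x_{ji(t-\tau_{ji})}\bigr)=s_{it}\quad\forall i\in[n],\,t\in\mathcal T,$$ $$u^k_{ijt}\ge 0\quad\forall k\in[K],\,i,j\in[n],\,t\in\mathcal T,$$ $$u^k_{ijt}\ge\lambda^k_{ijt}-x_{ijt}\quad\forall k\in[K],\,i,j\in[n],\,t\in\mathcal T,$$ $$x\in\mathbb{R}^{n^2T},\qquad u^k\in\mathbb{R}^{n^2T}\ \ \forall k\in[K].$$ This problem is totally unimodular (a linear program being totally unimodular means that it always has optimal solutions that are integer valued).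
   Context: $[n]=\{1,\dots,n\}$ is the set of stations, $\mathcal T=\{1,\dots,T\}$ the time horizon, $[K]=\{1,\dots,K\}$. The travel time $\tau_{ij}$ from $i$ to $j$ is an integer number of time steps. $s_{it}\in\mathbb{N}$ is the number of vehicles that become available at station $i$ at time $t$: vehicles idle at $i$ at the start are counted at $t=1$, and vehicles busy at the start are counted at the time and station at which they finish their current task. $\lambda^k_{ijt}\in\mathbb{N}$ is the $k$-th sample of the demand from $i$ to $j$ at time $t$, and $c_x\in\mathbb{R}^{n^2T}$ is a cost vector. The variables $x_{ijt}$ (number of vehicles departing from $i$ to $j$ at time $t$) and $u^k_{ijt}$ are indexed by $i,j\in[n]$, $t\in\mathcal T$ (and $k\in[K]$); in the flow constraint only terms with $t-\tau_{ji}\in\mathcal T$ are components of $x$, and the others do not appear. The integer program being relaxed is: minimize $c_x^Tx+c_w^Tw+\frac{c_\lambda}{K}\sum_{k}\sum_{ijt}u^k_{ijt}$ over $x,w,u^1,\dots,u^K\in\mathbb{N}^{n^2T}$ subject to the same flow constraint, $\sum_{t\in\mathcal T}w_{ijt}=\lambda_{ij0}$ (with $\lambda_{ij0}$ the number of outstanding customers from $i$ to $j$), $u^k_{ijt}\ge 0$ and $u^k_{ijt}\ge\lambda^k_{ijt}+w_{ijt}-x_{ijt}$, where $c_w$ is a cost vector and $c_\lambda$ a scalar cost. In the relaxation, outstanding customers are handled separately, so $w=0$ and the constraint on $w$ is dropped, and the integrality constraints are removed.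
   Formalization: "Always has optimal solutions that are integer valued" is proved for programs that are feasible with objective bounded below (and K ≥ 1); for other data, e.g. costs making the objective unbounded since x is unrestricted in sign, no optimal solution exists. *)

theory Defs
  imports Complex_Main
begin

text \<open>
  Stations are the elements of \<open>{1..n}\<close>, times those of \<open>{1..int T}\<close> and samples those of \<open>{1..K}\<close>.
  Vectors indexed by stations, times and samples are curried functions, of which only the values
  at indices in these ranges play a role. Times are integers, so that \<open>t - \<tau> j i\<close> is not truncated.
\<close>

type_synonym flow = "nat \<Rightarrow> nat \<Rightarrow> int \<Rightarrow> real"
type_synonym unmet = "nat \<Rightarrow> nat \<Rightarrow> nat \<Rightarrow> int \<Rightarrow> real"

text \<open>Arrivals whose departure time lies outside the horizon are not variables of the program.\<close>

definition flow_conservation ::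
  "nat \<Rightarrow> nat \<Rightarrow> (nat \<Rightarrow> nat \<Rightarrow> int) \<Rightarrow> (nat \<Rightarrow> int \<Rightarrow> nat) \<Rightarrow> flow \<Rightarrow> bool" where
  "flow_conservation n T \<tau> s x \<longleftrightarrow>
     (\<forall>i\<in>{1..n}. \<forall>t\<in>{1..int T}.
        (\<Sum>j\<in>{1..n}. x i j t -
           (if t - \<tau> j i \<in> {1..int T} then x j i (t - \<tau> j i) else 0)) = real (s i t))"

text \<open>Following the linear program as displayed, \<open>x\<close> is not constrained in sign.\<close>

definition lp_feasible ::
  "nat \<Rightarrow> nat \<Rightarrow> nat \<Rightarrow> (nat \<Rightarrow> nat \<Rightarrow> int) \<Rightarrow> (nat \<Rightarrow> int \<Rightarrow> nat) \<Rightarrow>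
   (nat \<Rightarrow> nat \<Rightarrow> nat \<Rightarrow> int \<Rightarrow> nat) \<Rightarrow> (flow \<times> unmet) set" where
  "lp_feasible n T K \<tau> s dem =
     {(x, u). flow_conservation n T \<tau> s x \<and>
        (\<forall>k\<in>{1..K}. \<forall>i\<in>{1..n}. \<forall>j\<in>{1..n}. \<forall>t\<in>{1..int T}.
           u k i j t \<ge> 0 \<and> u k i j t \<ge> real (dem k i j t) - x i j t)}"

definition lp_objective ::
  "nat \<Rightarrow> nat \<Rightarrow> nat \<Rightarrow> (nat \<Rightarrow> nat \<Rightarrow> int \<Rightarrow> real) \<Rightarrow> flow \<times> unmet \<Rightarrow> real" where
  "lp_objective n T K c = (\<lambda>(x, u).
     (\<Sum>i\<in>{1..n}. \<Sum>j\<in>{1..n}. \<Sum>t\<in>{1..int T}. c i j t * x i j t) +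
     1 / real K * (\<Sum>k\<in>{1..K}. \<Sum>i\<in>{1..n}. \<Sum>j\<in>{1..n}. \<Sum>t\<in>{1..int T}. u k i j t))"

definition integer_valued :: "nat \<Rightarrow> nat \<Rightarrow> nat \<Rightarrow> (flow \<times> unmet) set" where
  "integer_valued n T K =
     {(x, u). \<forall>i\<in>{1..n}. \<forall>j\<in>{1..n}. \<forall>t\<in>{1..int T}.
        x i j t \<in> \<int> \<and> (\<forall>k\<in>{1..K}. u k i j t \<in> \<int>)}"

text \<open>
  Minimizing \<open>f\<close> over \<open>F\<close>, with \<open>Z\<close> the integer-valued points: there is an integer-valued
  optimal solution. The premise says that the optimal value is finite; the costs being
  arbitrary, the program may be unbounded, and it may be infeasible if some travel times
  vanish. In these cases no optimal solution exists at all. That the infimum is attained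
  is part of the conclusion.
\<close>

definition totally_unimodular_lp :: "'v set \<Rightarrow> ('v \<Rightarrow> real) \<Rightarrow> 'v set \<Rightarrow> bool" where
  "totally_unimodular_lp F f Z \<longleftrightarrow>
     (F \<noteq> {} \<and> bdd_below (f ` F) \<longrightarrow> (\<exists>v\<in>Z. is_arg_min f (\<lambda>w. w \<in> F) v))"

end

theory Submission
  imports Defs
begin

text \<open>
  For fixed \<open>x\<close> the best \<open>u\<close> is the positive part of the unmet demand, which leaves a separable
  piecewise linear cost of \<open>x\<close> on the flows of a time-expanded network, with breakpoints at the
  demand samples. From a flow \<open>x\<close>, moving along a circulation supported on the arcs whose flow is
  not at a breakpoint changes the cost linearly until an arc reaches a breakpoint; since the cost is
  bounded below, this can be done without increasing it. One ends in a flow such that no such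
  circulation is left. These flows are determined by which arcs sit at which breakpoints, so their
  costs form a finite set and the minimum is attained. They are integral: the breakpoints are
  integers, and the fractional arcs of a flow with integral net outflows carry a nonzero circulation.
\<close>

section \<open>Net outflows, circulations and integrality\<close>

definition net_outflow :: "'a set \<Rightarrow> ('a \<Rightarrow> 'v) \<Rightarrow> ('a \<Rightarrow> 'v) \<Rightarrow> ('a \<Rightarrow> real) \<Rightarrow> 'v \<Rightarrow> real" where
  "net_outflow A src dst x v = (\<Sum>a\<in>A. x a * (of_bool (src a = v) - of_bool (dst a = v)))"

lemma net_outflow_add_scaled:
  "net_outflow A src dst (\<lambda>a. x a + \<theta> * z a) v = net_outflow A src dst x v + \<theta> * net_outflow A src dst z v"
  unfolding net_outflow_def sum_distrib_left sum.distrib[symmetric]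
  by (intro sum.cong) (auto simp: algebra_simps)

lemma net_outflow_diff:
  "net_outflow A src dst (\<lambda>a. x a - y a) v = net_outflow A src dst x v - net_outflow A src dst y v"
  unfolding net_outflow_def sum_subtractf[symmetric]
  by (intro sum.cong) (auto simp: algebra_simps)

lemma net_outflow_insert:
  assumes "finite F" "e \<notin> F"
  shows "net_outflow (insert e F) src dst x v =
    x e * (of_bool (src e = v) - of_bool (dst e = v)) + net_outflow F src dst x v"
  using assms by (simp add: net_outflow_def)

lemma net_outflow_cong:
  assumes "\<And>a. a \<in> F \<Longrightarrow> x a = y a"
  shows "net_outflow F src dst x v = net_outflow F src dst y v"
  using assms by (simp add: net_outflow_def)

text \<open>Merging \<open>r\<close> into \<open>q\<close> turns the arcs between them into loops,
  which contribute nothing, just as their contributions at \<open>r\<close> and \<open>q\<close>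
  cancel.\<close>

lemma net_outflow_contract:
  assumes "r \<noteq> q" "v \<noteq> r"
  shows "net_outflow F (\<lambda>a. if src a = r then q else src a) (\<lambda>a. if dst a = r then q else dst a) y v =
    net_outflow F src dst y v + of_bool (v = q) * net_outflow F src dst y r"
  unfolding net_outflow_def sum_distrib_left sum.distrib[symmetric]
  using assms by (intro sum.cong) (auto simp: of_bool_def)

text \<open>By contracting one arc: the value on the contracted arc is recovered from the
  conservation law at the node that disappears.\<close>

lemma ex_circulation_on_fractional_arcs:
  fixes x :: "'a \<Rightarrow> real"
  assumes "finite F" "F \<noteq> {}" "\<And>a. a \<in> F \<Longrightarrow> x a \<notin> \<int>"
    and "\<And>v. v \<in> V \<Longrightarrow> net_outflow F src dst x v \<in> \<int>"
  shows "\<exists>z. (\<exists>a\<in>F. z a \<noteq> 0) \<and> (\<forall>v\<in>V. net_outflow F src dst z v = 0)"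
  using assms
proof (induction F arbitrary: V src dst rule: finite_induct)
  case empty
  then show ?case by simp
next
  case (insert e F)
  note ins = net_outflow_insert[OF insert.hyps]
  show ?case
  proof (cases "src e = dst e \<or> src e \<notin> V \<and> dst e \<notin> V")
    \<comment> \<open>A loop, or an arc with both ends outside \<open>V\<close>, affects no
      conservation law, so its indicator is already a circulation.\<close>
    case True
    have "net_outflow F src dst (\<lambda>a. of_bool (a = e)) v = 0" for v
      using insert.hyps by (auto simp: net_outflow_def intro!: sum.neutral)
    with True show ?thesis
      by (intro exI[of _ "\<lambda>a. of_bool (a = e)"]) (auto simp: ins)
  next
    case False
    \<comment> \<open>An end \<open>r\<close> of \<open>e\<close> that carries a conservation law is
      merged into the other end \<open>q\<close>, which may lie outside \<open>V\<close>.\<close>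
    then obtain r q where rq: "r \<in> V" "r \<noteq> q" "src e = r \<and> dst e = q \<or> src e = q \<and> dst e = r"
      by metis
    define \<epsilon> :: real where "\<epsilon> = of_bool (src e = r) - of_bool (dst e = r)"
    have \<epsilon>: "\<epsilon> = 1 \<or> \<epsilon> = -1" using rq by (auto simp: \<epsilon>_def)
    have sign: "of_bool (src e = v) - of_bool (dst e = v)
        = \<epsilon> * (of_bool (v = r) - of_bool (v = q))" for v
      using rq by (auto simp: \<epsilon>_def of_bool_def)
    let ?src = "\<lambda>a. if src a = r then q else src a" and ?dst = "\<lambda>a. if dst a = r then q else dst a"
    \<comment> \<open>Were \<open>e\<close> the only arc, its fractional value would be, up to sign,
      the integral net outflow at \<open>r\<close>.\<close>
    have "F \<noteq> {}"
    proof
      assume "F = {}"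
      then have "x e * \<epsilon> \<in> \<int>"
        using insert.prems(3)[OF rq(1)] rq by (simp add: net_outflow_def \<epsilon>_def)
      with \<epsilon> insert.prems(2)[of e] show False by auto
    qed
    \<comment> \<open>At the merged node the contributions of \<open>e\<close> at \<open>r\<close>
      and \<open>q\<close> cancel; at all other nodes nothing changes.\<close>
    moreover have "net_outflow F ?src ?dst x v \<in> \<int>" if "v \<in> V - {r}" for v
    proof (cases "v = q")
      case True
      have "net_outflow F ?src ?dst x v =
          net_outflow (insert e F) src dst x q + net_outflow (insert e F) src dst x r"
        using True that rq by (simp add: net_outflow_contract ins sign)
      with True that rq insert.prems(3) show ?thesis by auto
    next
      case False
      then have "net_outflow F ?src ?dst x v = net_outflow (insert e F) src dst x v"
        using that rq by (simp add: net_outflow_contract ins sign)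
      with that insert.prems(3) show ?thesis by auto
    qed
    ultimately obtain z where z: "\<exists>a\<in>F. z a \<noteq> 0"
        "\<forall>v\<in>V - {r}. net_outflow F ?src ?dst z v = 0"
      using insert.IH[of "V - {r}" ?src ?dst] insert.prems(2) by auto
    define z' where "z' = z(e := - \<epsilon> * net_outflow F src dst z r)"
    have same: "net_outflow F src dst z' v = net_outflow F src dst z v" for v
      using insert.hyps by (intro net_outflow_cong) (auto simp: z'_def)
    have "z' e = - \<epsilon> * net_outflow F src dst z r" by (simp add: z'_def)
    note step = ins sign same this
    have "net_outflow (insert e F) src dst z' v = 0" if "v \<in> V" for v
    proof (cases "v = r")
      case True
      then show ?thesis using \<epsilon> rq by (auto simp: step)
    next
      \<comment> \<open>At \<open>q\<close> the arc \<open>e\<close> contributes exactly the net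
        outflow of \<open>F\<close> at \<open>r\<close>, so the law at \<open>q\<close> is that of
        the merged node.\<close>
      case False
      then have "net_outflow F src dst z v + of_bool (v = q) * net_outflow F src dst z r = 0"
        using z(2) that rq by (simp add: net_outflow_contract)
      then show ?thesis using \<epsilon> rq False by (auto simp: step)
    qed
    moreover have "\<exists>a\<in>insert e F. z' a \<noteq> 0"
      using z(1) insert.hyps by (auto simp: z'_def)
    ultimately show ?thesis by blast
  qed
qed

text \<open>The integral arcs contribute integrally at every node, so the fractional arcs alone have
  integral net outflows on \<open>V\<close>. They would carry a nonzero circulation, whose extension
  by zero contradicts \<open>triv\<close>.\<close>

lemma integral_if_no_circulation:
  fixes x :: "'a \<Rightarrow> real"
  assumes "finite A" "\<And>v. v \<in> V \<Longrightarrow> net_outflow A src dst x v \<in> \<int>"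
    and triv: "\<And>z. \<forall>v\<in>V. net_outflow A src dst z v = 0 \<Longrightarrow> \<forall>a\<in>A. x a \<in> \<int> \<longrightarrow> z a = 0 \<Longrightarrow>
      \<forall>a\<in>A. z a = 0"
    and "a \<in> A"
  shows "x a \<in> \<int>"
proof (rule ccontr)
  assume "x a \<notin> \<int>"
  define F where "F = {a\<in>A. x a \<notin> \<int>}"
  have F: "finite F" "F \<noteq> {}" "F \<subseteq> A" using assms \<open>x a \<notin> \<int>\<close> by (auto simp: F_def)
  have split: "net_outflow A src dst y v = net_outflow (A - F) src dst y v + net_outflow F src dst y v" for y v
    unfolding net_outflow_def using F assms(1) by (intro sum.subset_diff)
  have "net_outflow (A - F) src dst x v \<in> \<int>" for v
    unfolding net_outflow_def by (intro Ints_sum Ints_mult Ints_diff) (auto simp: F_def of_bool_def)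
  then have int: "net_outflow F src dst x v \<in> \<int>" if "v \<in> V" for v
    using assms(2)[OF that] split[of x v] by (metis Ints_diff add_diff_cancel_left')
  have frac: "x a \<notin> \<int>" if "a \<in> F" for a using that by (simp add: F_def)
  obtain z where z: "\<exists>a\<in>F. z a \<noteq> 0" "\<forall>v\<in>V. net_outflow F src dst z v = 0"
    using ex_circulation_on_fractional_arcs[OF F(1,2) frac int] by blast
  define z' where "z' a = (if a \<in> F then z a else 0)" for a
  have "net_outflow F src dst z' v = net_outflow F src dst z v" for v
    by (intro net_outflow_cong) (auto simp: z'_def)
  moreover have "net_outflow (A - F) src dst z' v = 0" for v
    unfolding net_outflow_def by (intro sum.neutral) (auto simp: z'_def)
  ultimately have "\<forall>v\<in>V. net_outflow A src dst z' v = 0"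
    using z(2) split by simp
  then have "\<forall>a\<in>A. z' a = 0" by (rule triv) (auto simp: z'_def F_def)
  with z(1) F(3) show False unfolding z'_def by (metis subsetD)
qed

section \<open>The cost of a flow once the optimal \<open>u\<close> is eliminated, and its behaviour
  along lines\<close>

definition shortfall_cost ::
  "'a set \<Rightarrow> 'k set \<Rightarrow> ('k \<Rightarrow> 'a \<Rightarrow> real) \<Rightarrow> real \<Rightarrow> ('a \<Rightarrow> real) \<Rightarrow> ('a \<Rightarrow> real) \<Rightarrow> real" where
  "shortfall_cost A I d \<kappa> c x = (\<Sum>a\<in>A. c a * x a + \<kappa> * (\<Sum>k\<in>I. max 0 (d k a - x a)))"

text \<open>The derivative of \<open>shortfall_cost\<close> at \<open>x\<close> in direction
  \<open>z\<close>, provided that \<open>x\<close> avoids the breakpoints on the support of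
  \<open>z\<close>.\<close>

definition shortfall_slope ::
  "'a set \<Rightarrow> 'k set \<Rightarrow> ('k \<Rightarrow> 'a \<Rightarrow> real) \<Rightarrow> real \<Rightarrow> ('a \<Rightarrow> real) \<Rightarrow> ('a \<Rightarrow> real) \<Rightarrow> ('a \<Rightarrow> real) \<Rightarrow> real" where
  "shortfall_slope A I d \<kappa> c x z = (\<Sum>a\<in>A. z a * (c a - \<kappa> * (\<Sum>k\<in>I. of_bool (d k a > x a))))"

lemma shortfall_slope_uminus:
  "shortfall_slope A I d \<kappa> c x (\<lambda>a. - z a) = - shortfall_slope A I d \<kappa> c x z"
  by (simp add: shortfall_slope_def sum_negf)

text \<open>Each positive part is affine on either side of its breakpoint, and the hypothesis keeps
  the segment on one side; only its far end may touch the breakpoint.\<close>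

lemma shortfall_cost_along_line:
  assumes "\<And>a k. a \<in> A \<Longrightarrow> k \<in> I \<Longrightarrow> z a \<noteq> 0 \<Longrightarrow>
    x a < d k a \<and> x a + \<theta> * z a \<le> d k a \<or> d k a < x a \<and> d k a \<le> x a + \<theta> * z a"
  shows "shortfall_cost A I d \<kappa> c (\<lambda>a. x a + \<theta> * z a) =
    shortfall_cost A I d \<kappa> c x + \<theta> * shortfall_slope A I d \<kappa> c x z"
  unfolding shortfall_cost_def shortfall_slope_def sum_distrib_left[of \<theta>] sum.distrib[symmetric]
proof (intro sum.cong refl)
  fix a assume a: "a \<in> A"
  have "max 0 (d k a - (x a + \<theta> * z a)) = max 0 (d k a - x a) - \<theta> * z a * of_bool (d k a > x a)"
    if "k \<in> I" for k
    using assms[OF a that] by (cases "z a = 0") (auto simp: max_def)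
  then have "(\<Sum>k\<in>I. max 0 (d k a - (x a + \<theta> * z a))) =
      (\<Sum>k\<in>I. max 0 (d k a - x a)) - \<theta> * z a * (\<Sum>k\<in>I. of_bool (d k a > x a))"
    by (simp add: sum_subtractf sum_distrib_left)
  then show "c a * (x a + \<theta> * z a) + \<kappa> * (\<Sum>k\<in>I. max 0 (d k a - (x a + \<theta> * z a))) =
      c a * x a + \<kappa> * (\<Sum>k\<in>I. max 0 (d k a - x a)) +
      \<theta> * (z a * (c a - \<kappa> * (\<Sum>k\<in>I. of_bool (x a < d k a))))"
    by (simp only:) (simp add: algebra_simps)
qed

text \<open>The moving point meets \<open>d\<close> at parameter \<open>(d - p) / z\<close>; if this
  is negative, it moves away from \<open>d\<close>.\<close>

lemma no_breakpoint_crossed: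
  fixes p d z \<theta> :: real
  assumes "p \<noteq> d" "z \<noteq> 0" "0 \<le> \<theta>" "0 < (d - p) / z \<Longrightarrow> \<theta> \<le> (d - p) / z"
  shows "p < d \<and> p + \<theta> * z \<le> d \<or> d < p \<and> d \<le> p + \<theta> * z"
proof (cases "p < d")
  case True
  show ?thesis
  proof (cases "z > 0")
    case True
    then show ?thesis using \<open>p < d\<close> assms(4) by (simp add: pos_le_divide_eq algebra_simps)
  next
    case False
    then have "\<theta> * z \<le> 0" using assms by (simp add: mult_nonneg_nonpos)
    then show ?thesis using \<open>p < d\<close> by linarith
  qed
next
  case False
  then have "d < p" using assms by simp
  show ?thesis
  proof (cases "z < 0")
    case True
    then have "0 < (d - p) / z" using \<open>d < p\<close> by (simp add: divide_neg_neg)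
    then have "\<theta> \<le> (d - p) / z" by (rule assms(4))
    then show ?thesis using True \<open>d < p\<close> by (simp add: neg_le_divide_eq algebra_simps)
  next
    case False
    then have "0 \<le> \<theta> * z" using assms by simp
    then show ?thesis using \<open>d < p\<close> by linarith
  qed
qed

section \<open>Descent to flows with fewer free arcs\<close>

definition free_arcs :: "'a set \<Rightarrow> 'k set \<Rightarrow> ('k \<Rightarrow> 'a \<Rightarrow> real) \<Rightarrow> ('a \<Rightarrow> real) \<Rightarrow> 'a set" where
  "free_arcs A I d x = {a\<in>A. \<forall>k\<in>I. x a \<noteq> d k a}"

text \<open>Walk along \<open>z\<close> up to the first breakpoint. The cost is affine until then
  and does not rise. The arc that meets the breakpoint stops being free, and no arc becomes free,
  since the others do not move.\<close>

lemma descend_to_breakpoint: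
  assumes "finite A" "finite I"
    and supp: "\<And>a. a \<in> A \<Longrightarrow> z a \<noteq> 0 \<Longrightarrow> a \<in> free_arcs A I d x"
    and slope: "shortfall_slope A I d \<kappa> c x z \<le> 0"
    and hit: "a0 \<in> A" "k0 \<in> I" "z a0 \<noteq> 0" "0 < (d k0 a0 - x a0) / z a0"
  shows "\<exists>\<theta>. shortfall_cost A I d \<kappa> c (\<lambda>a. x a + \<theta> * z a) \<le> shortfall_cost A I d \<kappa> c x \<and>
    free_arcs A I d (\<lambda>a. x a + \<theta> * z a) \<subset> free_arcs A I d x"
proof -
  \<comment> \<open>The positive parameters at which a moving arc meets one of its breakpoints;
    \<open>hit\<close> provides one.\<close>
  define H where "H = {h \<in> (\<lambda>(a, k). (d k a - x a) / z a) ` ({a\<in>A. z a \<noteq> 0} \<times> I). 0 < h}"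
  have "finite H" unfolding H_def using assms(1,2) by auto
  have "(d k0 a0 - x a0) / z a0 \<in> H" unfolding H_def using hit by force
  define \<theta> where "\<theta> = Min H"
  have "\<theta> \<in> H" using \<open>finite H\<close> \<open>_ \<in> H\<close> Min_in unfolding \<theta>_def by blast
  then obtain a k where ak: "a \<in> A" "k \<in> I" "z a \<noteq> 0" "\<theta> = (d k a - x a) / z a" "\<theta> > 0"
    unfolding H_def by auto
  have "shortfall_cost A I d \<kappa> c (\<lambda>a. x a + \<theta> * z a) =
      shortfall_cost A I d \<kappa> c x + \<theta> * shortfall_slope A I d \<kappa> c x z"
  proof (intro shortfall_cost_along_line no_breakpoint_crossed)
    fix a k assume "a \<in> A" "k \<in> I" "z a \<noteq> 0"
    then show "x a \<noteq> d k a" using supp by (auto simp: free_arcs_def)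
    assume "0 < (d k a - x a) / z a"
    then have "(d k a - x a) / z a \<in> H"
      unfolding H_def using \<open>a \<in> A\<close> \<open>k \<in> I\<close> \<open>z a \<noteq> 0\<close> by force
    then show "\<theta> \<le> (d k a - x a) / z a" using \<open>finite H\<close> by (simp add: \<theta>_def)
  qed (use ak in auto)
  moreover have "\<theta> * shortfall_slope A I d \<kappa> c x z \<le> 0"
    using slope \<open>\<theta> > 0\<close> by (simp add: mult_nonneg_nonpos)
  moreover have "free_arcs A I d (\<lambda>a. x a + \<theta> * z a) \<subseteq> free_arcs A I d x"
  proof
    fix b assume b: "b \<in> free_arcs A I d (\<lambda>a. x a + \<theta> * z a)"
    then show "b \<in> free_arcs A I d x"
      using supp[of b] by (cases "z b = 0") (auto simp: free_arcs_def)
  qed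
  moreover have "x a + \<theta> * z a = d k a" using ak by simp
  then have "a \<notin> free_arcs A I d (\<lambda>a. x a + \<theta> * z a)" using ak by (auto simp: free_arcs_def)
  ultimately show ?thesis using supp[OF ak(1,3)] by (intro exI[of _ \<theta>]) auto
qed

text \<open>With no breakpoint ahead the cost is affine on the whole ray, so a negative slope would
  violate the lower bound \<open>m\<close>.\<close>

lemma slope_nonneg_if_no_breakpoint_ahead:
  assumes supp: "\<And>a. a \<in> A \<Longrightarrow> z a \<noteq> 0 \<Longrightarrow> a \<in> free_arcs A I d x"
    and bdd: "\<And>\<theta>. m \<le> shortfall_cost A I d \<kappa> c (\<lambda>a. x a + \<theta> * z a)"
    and no_hit: "\<And>a k. a \<in> A \<Longrightarrow> k \<in> I \<Longrightarrow> z a \<noteq> 0 \<Longrightarrow> \<not> 0 < (d k a - x a) / z a"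
  shows "0 \<le> shortfall_slope A I d \<kappa> c x z"
proof (rule ccontr)
  let ?L = "shortfall_slope A I d \<kappa> c x z" and ?f = "shortfall_cost A I d \<kappa> c"
  assume neg: "\<not> 0 \<le> ?L"
  \<comment> \<open>Chosen so that the affine cost takes the value \<open>m - 1\<close>.\<close>
  define \<theta> where "\<theta> = (m - ?f x - 1) / ?L"
  have "m \<le> ?f x" using bdd[of 0] by simp
  then have "0 \<le> \<theta>" using neg by (simp add: \<theta>_def divide_nonpos_neg)
  then have "?f (\<lambda>a. x a + \<theta> * z a) = ?f x + \<theta> * ?L"
    using supp no_hit
    by (intro shortfall_cost_along_line no_breakpoint_crossed) (auto simp: free_arcs_def)
  also have "\<dots> = m - 1" using neg by (simp add: \<theta>_def)
  finally show False using bdd[of \<theta>] by simp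
qed

text \<open>The slopes along \<open>z\<close> and its negative are opposite, and a breakpoint of a
  moving arc lies ahead in one of these directions. If both have one ahead, take one that does not
  ascend. If only one has, the other has nonnegative slope, so again there is a direction to
  descend.\<close>

lemma reduce_free_arcs:
  assumes "finite A" "finite I" "I \<noteq> {}"
    and supp: "\<And>a. a \<in> A \<Longrightarrow> z a \<noteq> 0 \<Longrightarrow> a \<in> free_arcs A I d x"
    and bdd: "\<And>\<theta>. m \<le> shortfall_cost A I d \<kappa> c (\<lambda>a. x a + \<theta> * z a)"
    and nz: "\<exists>a\<in>A. z a \<noteq> 0"
  shows "\<exists>\<theta>. shortfall_cost A I d \<kappa> c (\<lambda>a. x a + \<theta> * z a) \<le> shortfall_cost A I d \<kappa> c x \<and>
    free_arcs A I d (\<lambda>a. x a + \<theta> * z a) \<subset> free_arcs A I d x"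
proof -
  let ?L = "shortfall_slope A I d \<kappa> c x"
  let ?ahead = "\<lambda>z. \<exists>a\<in>A. \<exists>k\<in>I. z a \<noteq> 0 \<and> 0 < (d k a - x a) / z a"
  let ?z' = "\<lambda>a. - z a"
  have bdd': "m \<le> shortfall_cost A I d \<kappa> c (\<lambda>a. x a + \<theta> * ?z' a)" for \<theta>
    using bdd[of "- \<theta>"] by simp
  have supp': "a \<in> free_arcs A I d x" if "a \<in> A" "?z' a \<noteq> 0" for a using supp that by simp
  obtain a k where "a \<in> A" "k \<in> I" "z a \<noteq> 0" using nz assms(3) by auto
  then have "x a \<noteq> d k a" using supp[of a] by (auto simp: free_arcs_def)
  then have "0 < (d k a - x a) / z a \<or> 0 < (d k a - x a) / - z a"
    using \<open>z a \<noteq> 0\<close> by (auto simp: zero_less_divide_iff divide_less_0_iff)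
  then have "?ahead z \<or> ?ahead ?z'"
    using \<open>a \<in> A\<close> \<open>k \<in> I\<close> \<open>z a \<noteq> 0\<close> by (metis neg_equal_0_iff_equal)
  moreover have "0 \<le> ?L z" if "\<not> ?ahead z"
    using that supp by (intro slope_nonneg_if_no_breakpoint_ahead[OF _ bdd]) auto
  moreover have "0 \<le> ?L ?z'" if "\<not> ?ahead ?z'"
    using that supp' by (intro slope_nonneg_if_no_breakpoint_ahead[OF _ bdd']) auto
  ultimately have "?L z \<le> 0 \<and> ?ahead z \<or> ?L ?z' \<le> 0 \<and> ?ahead ?z'"
    unfolding shortfall_slope_uminus by linarith
  then show ?thesis
  proof
    assume "?L z \<le> 0 \<and> ?ahead z"
    then show ?thesis using descend_to_breakpoint[OF assms(1,2) supp] by blast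
  next
    assume *: "?L ?z' \<le> 0 \<and> ?ahead ?z'"
    then obtain \<theta> where "shortfall_cost A I d \<kappa> c (\<lambda>a. x a + \<theta> * ?z' a) \<le> shortfall_cost A I d \<kappa> c x \<and>
        free_arcs A I d (\<lambda>a. x a + \<theta> * ?z' a) \<subset> free_arcs A I d x"
      using descend_to_breakpoint[where z = ?z', OF assms(1,2) supp'] by blast
    then show ?thesis by (intro exI[of _ "- \<theta>"]) simp
  qed
qed

section \<open>Basic flows: vertices of the subdivision cut out by the breakpoints\<close>

definition basic_flows ::
  "'a set \<Rightarrow> 'v set \<Rightarrow> ('a \<Rightarrow> 'v) \<Rightarrow> ('a \<Rightarrow> 'v) \<Rightarrow> ('v \<Rightarrow> real) \<Rightarrow> 'k set \<Rightarrow> ('k \<Rightarrow> 'a \<Rightarrow> real) \<Rightarrow>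
    ('a \<Rightarrow> real) set" where
  "basic_flows A V src dst b I d = {x. (\<forall>v\<in>V. net_outflow A src dst x v = b v) \<and>
    (\<forall>z. (\<forall>v\<in>V. net_outflow A src dst z v = 0) \<longrightarrow> (\<forall>a\<in>A. z a \<noteq> 0 \<longrightarrow> a \<in> free_arcs A I d x) \<longrightarrow>
      (\<forall>a\<in>A. z a = 0))}"

text \<open>Induction on the number of free arcs: a flow that is not basic has a nonzero circulation
  on them, along which \<open>reduce_free_arcs\<close> lowers that number without raising the
  cost.\<close>

lemma basic_flow_below:
  assumes "finite A" "finite I" "I \<noteq> {}"
    and bdd: "\<And>y. (\<forall>v\<in>V. net_outflow A src dst y v = b v) \<Longrightarrow> m \<le> shortfall_cost A I d \<kappa> c y"
    and "\<forall>v\<in>V. net_outflow A src dst x v = b v"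
  shows "\<exists>y\<in>basic_flows A V src dst b I d. shortfall_cost A I d \<kappa> c y \<le> shortfall_cost A I d \<kappa> c x"
  using assms(5)
proof (induction "card (free_arcs A I d x)" arbitrary: x rule: less_induct)
  case less
  show ?case
  proof (cases "x \<in> basic_flows A V src dst b I d")
    case False
    then obtain z where z: "\<forall>v\<in>V. net_outflow A src dst z v = 0"
        "\<And>a. a \<in> A \<Longrightarrow> z a \<noteq> 0 \<Longrightarrow> a \<in> free_arcs A I d x" "\<exists>a\<in>A. z a \<noteq> 0"
      using less.prems by (auto simp: basic_flows_def)
    have feas: "\<forall>v\<in>V. net_outflow A src dst (\<lambda>a. x a + \<theta> * z a) v = b v" for \<theta>
      using z(1) less.prems by (simp add: net_outflow_add_scaled)
    obtain \<theta> where \<theta>: "shortfall_cost A I d \<kappa> c (\<lambda>a. x a + \<theta> * z a) \<le> shortfall_cost A I d \<kappa> c x"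
        "free_arcs A I d (\<lambda>a. x a + \<theta> * z a) \<subset> free_arcs A I d x"
      using reduce_free_arcs[OF assms(1-3) z(2) bdd[OF feas] z(3)] by blast
    have "card (free_arcs A I d (\<lambda>a. x a + \<theta> * z a)) < card (free_arcs A I d x)"
      using \<theta>(2) assms(1) by (intro psubset_card_mono) (auto simp: free_arcs_def)
    from less.hyps[OF this feas] \<theta>(1) show ?thesis by (meson order_trans)
  qed auto
qed

text \<open>A basic flow is determined by its incidences with breakpoints.\<close>

lemma finite_cost_basic_flows:
  assumes "finite A" "finite I"
  shows "finite (shortfall_cost A I d \<kappa> c ` basic_flows A V src dst b I d)"
proof -
  let ?B = "basic_flows A V src dst b I d" and ?f = "shortfall_cost A I d \<kappa> c"
  define P where "P x = {(a, k) \<in> A \<times> I. x a = d k a}" for x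
  \<comment> \<open>Where \<open>x\<close> sits at a breakpoint, \<open>y\<close> sits at the same
    one. Hence their difference is a circulation on the free arcs of \<open>x\<close>, which
    vanishes on \<open>A\<close> because \<open>x\<close> is basic.\<close>
  have eq: "?f x = ?f y" if "x \<in> ?B" "y \<in> ?B" "P x = P y" for x y
  proof -
    have "\<forall>v\<in>V. net_outflow A src dst (\<lambda>a. x a - y a) v = 0"
      using that by (simp add: basic_flows_def net_outflow_diff)
    moreover have "\<forall>a\<in>A. x a - y a \<noteq> 0 \<longrightarrow> a \<in> free_arcs A I d x"
    proof (intro ballI impI)
      fix a assume a: "a \<in> A" "x a - y a \<noteq> 0"
      have "x a \<noteq> d k a" if "k \<in> I" for k
      proof
        assume "x a = d k a"
        then have "(a, k) \<in> P x" using a \<open>k \<in> I\<close> by (simp add: P_def)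
        then have "(a, k) \<in> P y" using \<open>P x = P y\<close> by simp
        with \<open>x a = d k a\<close> a show False by (simp add: P_def)
      qed
      then show "a \<in> free_arcs A I d x" using a by (simp add: free_arcs_def)
    qed
    ultimately have "\<forall>a\<in>A. x a - y a = 0" using that(1) unfolding basic_flows_def by blast
    \<comment> \<open>The flows agree on \<open>A\<close> only, values off \<open>A\<close> being
      arbitrary; this is why costs are counted rather than flows.\<close>
    then show ?thesis by (simp add: shortfall_cost_def)
  qed
  \<comment> \<open>On basic flows the cost factors through \<open>P\<close>, which takes finitely
    many values.\<close>
  have "?f x = ?f (inv_into ?B P (P x))" if "x \<in> ?B" for x
    by (rule eq) (use that in \<open>auto intro: inv_into_into simp: f_inv_into_f\<close>)
  then have "?f ` ?B \<subseteq> (\<lambda>p. ?f (inv_into ?B P p)) ` P ` ?B"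
    by (simp add: image_subset_iff)
  moreover have "finite (P ` ?B)"
    by (rule finite_subset[of _ "Pow (A \<times> I)"]) (use assms in \<open>auto simp: P_def\<close>)
  ultimately show ?thesis by (meson finite_imageI finite_subset)
qed

text \<open>Breakpoints are integers, so fractional arcs are free, and a basic flow leaves no
  nonzero circulation on them.\<close>

lemma basic_flow_integral:
  assumes "finite A" "x \<in> basic_flows A V src dst b I d" "a \<in> A"
    and "\<And>v. v \<in> V \<Longrightarrow> b v \<in> \<int>" "\<And>k a. k \<in> I \<Longrightarrow> a \<in> A \<Longrightarrow> d k a \<in> \<int>"
  shows "x a \<in> \<int>"
proof (rule integral_if_no_circulation[OF assms(1) _ _ assms(3)])
  show "net_outflow A src dst x v \<in> \<int>" if "v \<in> V" for v
    using assms(2,4) that by (auto simp: basic_flows_def)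
  fix z assume z: "\<forall>v\<in>V. net_outflow A src dst z v = 0" "\<forall>a\<in>A. x a \<in> \<int> \<longrightarrow> z a = 0"
  have "\<forall>a\<in>A. z a \<noteq> 0 \<longrightarrow> a \<in> free_arcs A I d x"
  proof (intro ballI impI)
    fix a assume "a \<in> A" "z a \<noteq> 0"
    then have "x a \<notin> \<int>" using z(2) by auto
    then show "a \<in> free_arcs A I d x" using assms(5) \<open>a \<in> A\<close> by (auto simp: free_arcs_def)
  qed
  with z(1) show "\<forall>a\<in>A. z a = 0" using assms(2) unfolding basic_flows_def by blast
qed

text \<open>Every flow costs at least as much as some basic one, so the least of the finitely many
  costs of basic flows is the minimum over all flows.\<close>

theorem ex_integral_min_cost_flow:
  assumes "finite A" "finite I" "I \<noteq> {}"
    and b: "\<And>v. v \<in> V \<Longrightarrow> b v \<in> \<int>" and d: "\<And>k a. k \<in> I \<Longrightarrow> a \<in> A \<Longrightarrow> d k a \<in> \<int>"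
    and bdd: "\<And>y. (\<forall>v\<in>V. net_outflow A src dst y v = b v) \<Longrightarrow> m \<le> shortfall_cost A I d \<kappa> c y"
    and feas: "\<forall>v\<in>V. net_outflow A src dst x0 v = b v"
  obtains x where "\<forall>v\<in>V. net_outflow A src dst x v = b v" "\<And>a. a \<in> A \<Longrightarrow> x a \<in> \<int>"
    "\<And>y. (\<forall>v\<in>V. net_outflow A src dst y v = b v) \<Longrightarrow>
      shortfall_cost A I d \<kappa> c x \<le> shortfall_cost A I d \<kappa> c y"
proof -
  let ?B = "basic_flows A V src dst b I d" and ?f = "shortfall_cost A I d \<kappa> c"
  note below = basic_flow_below[of A I V src dst b, OF assms(1-3) bdd]
  have fin: "finite (?f ` ?B)" using assms(1,2) by (rule finite_cost_basic_flows)
  have "?f ` ?B \<noteq> {}" using below[OF _ feas] by auto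
  then obtain x where x: "x \<in> ?B" "Min (?f ` ?B) = ?f x" using Min_in[OF fin] by auto
  show thesis
  proof
    show "\<forall>v\<in>V. net_outflow A src dst x v = b v" using x by (simp add: basic_flows_def)
    show "x a \<in> \<int>" if "a \<in> A" for a
      using basic_flow_integral[OF assms(1) x(1) that b d] .
    fix y assume "\<forall>v\<in>V. net_outflow A src dst y v = b v"
    then obtain w where "w \<in> ?B" "?f w \<le> ?f y" using below by blast
    moreover have "?f x \<le> ?f w" using Min_le[OF fin, of "?f w"] x(2) \<open>w \<in> ?B\<close> by simp
    ultimately show "?f x \<le> ?f y" by linarith
  qed
qed

section \<open>The time-expanded network\<close>

lemma net_outflow_time_expanded:
  fixes x :: flow
  assumes "i \<in> {1..n}" "t \<in> {1..int T}"
  shows "net_outflow ({1..n} \<times> {1..n} \<times> {1..int T}) (\<lambda>(i, j, t). (i, t)) (\<lambda>(i, j, t). (j, t + \<tau> i j))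
      (\<lambda>(i, j, t). x i j t) (i, t) =
    (\<Sum>j\<in>{1..n}. x i j t - (if t - \<tau> j i \<in> {1..int T} then x j i (t - \<tau> j i) else 0))"
proof -
  have out: "(\<Sum>i'\<in>{1..n}. \<Sum>j\<in>{1..n}. \<Sum>t'\<in>{1..int T}. x i' j t' * of_bool (i' = i \<and> t' = t))
      = (\<Sum>j\<in>{1..n}. x i j t)"
  proof -
    have "(\<Sum>t'\<in>{1..int T}. x i' j t' * of_bool (i' = i \<and> t' = t)) = (if i' = i then x i' j t else 0)" for i' j
    proof -
      have "(\<Sum>t'\<in>{1..int T}. x i' j t' * of_bool (i' = i \<and> t' = t)) =
          (\<Sum>t'\<in>{1..int T}. if t' = t then (if i' = i then x i' j t else 0) else 0)"
        by (intro sum.cong) auto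
      then show ?thesis using assms by simp
    qed
    then have "(\<Sum>i'\<in>{1..n}. \<Sum>j\<in>{1..n}. \<Sum>t'\<in>{1..int T}. x i' j t' * of_bool (i' = i \<and> t' = t))
      = (\<Sum>i'\<in>{1..n}. if i' = i then (\<Sum>j\<in>{1..n}. x i j t) else 0)"
      by (intro sum.cong) auto
    then show ?thesis using assms by simp
  qed
  \<comment> \<open>From each station \<open>j\<close> at most one arc enters \<open>(i, t)\<close>:
    the one departing at \<open>t - \<tau> j i\<close>, present only if that time is in the
    horizon.\<close>
  have inn: "(\<Sum>i'\<in>{1..n}. \<Sum>j\<in>{1..n}. \<Sum>t'\<in>{1..int T}. x i' j t' * of_bool (j = i \<and> t' + \<tau> i' j = t))
      = (\<Sum>j\<in>{1..n}. if t - \<tau> j i \<in> {1..int T} then x j i (t - \<tau> j i) else 0)"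
  proof (intro sum.cong refl)
    fix i' assume "i' \<in> {1..n}"
    have "(\<Sum>t'\<in>{1..int T}. x i' j t' * of_bool (j = i \<and> t' + \<tau> i' j = t)) =
       (if j = i then (if t - \<tau> i' i \<in> {1..int T} then x i' i (t - \<tau> i' i) else 0) else 0)" for j
    proof -
      have "(\<Sum>t'\<in>{1..int T}. x i' j t' * of_bool (j = i \<and> t' + \<tau> i' j = t)) =
          (\<Sum>t'\<in>{1..int T}. if t' = t - \<tau> i' j then (if j = i then x i' i (t - \<tau> i' i) else 0) else 0)"
        by (intro sum.cong) auto
      then show ?thesis by (auto simp: sum.delta)
    qed
    then show "(\<Sum>j\<in>{1..n}. \<Sum>t'\<in>{1..int T}. x i' j t' * of_bool (j = i \<and> t' + \<tau> i' j = t)) =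
      (if t - \<tau> i' i \<in> {1..int T} then x i' i (t - \<tau> i' i) else 0)"
      using assms by (simp only: sum.delta finite_atLeastAtMost if_True)
  qed
  show ?thesis
    unfolding sum_subtractf out[symmetric] inn[symmetric] sum.cartesian_product
    by (simp only: net_outflow_def case_prod_unfold right_diff_distrib sum_subtractf prod.inject
        fst_conv snd_conv)
qed

text \<open>A trip is an arc from its departure to its arrival, both being pairs of station and
  time. A trip that ends outside the horizon has its head outside the constrained nodes.\<close>

lemma flow_conservation_iff_net_outflow:
  "flow_conservation n T \<tau> s x \<longleftrightarrow>
    (\<forall>v\<in>{1..n} \<times> {1..int T}. net_outflow ({1..n} \<times> {1..n} \<times> {1..int T}) (\<lambda>(i, j, t). (i, t)) (\<lambda>(i, j, t). (j, t + \<tau> i j))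
      (\<lambda>(i, j, t). x i j t) v = real (s (fst v) (snd v)))"
  by (simp add: flow_conservation_def net_outflow_time_expanded del: One_nat_def atLeastAtMost_iff)

lemma lp_objective_eq:
  "lp_objective n T K c (x, u) = (\<Sum>(i, j, t)\<in>{1..n} \<times> {1..n} \<times> {1..int T}.
     c i j t * x i j t + 1 / real K * (\<Sum>k\<in>{1..K}. u k i j t))"
proof -
  have "1 / real K * (\<Sum>k\<in>{1..K}. \<Sum>(i, j, t)\<in>{1..n} \<times> {1..n} \<times> {1..int T}. u k i j t) =
    (\<Sum>(i, j, t)\<in>{1..n} \<times> {1..n} \<times> {1..int T}. 1 / real K * (\<Sum>k\<in>{1..K}. u k i j t))"
    unfolding case_prod_unfold sum_distrib_left by (rule sum.swap)
  then show ?thesis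
    unfolding lp_objective_def
    by (simp only: sum.cartesian_product[symmetric] sum.distrib prod.case)
qed

section \<open>Transfer to the linear program\<close>

theorem lemma4:
  fixes n T K :: nat
    and \<tau> :: "nat \<Rightarrow> nat \<Rightarrow> int"
    and s :: "nat \<Rightarrow> int \<Rightarrow> nat"
    and dem :: "nat \<Rightarrow> nat \<Rightarrow> nat \<Rightarrow> int \<Rightarrow> nat"
    and c :: "nat \<Rightarrow> nat \<Rightarrow> int \<Rightarrow> real"
  assumes "K \<ge> 1"
  shows "totally_unimodular_lp (lp_feasible n T K \<tau> s dem) (lp_objective n T K c)
           (integer_valued n T K)"
  unfolding totally_unimodular_lp_def
proof (intro impI, elim conjE)
  let ?F = "lp_feasible n T K \<tau> s dem" and ?f = "lp_objective n T K c"
  assume "?F \<noteq> {}" and bdd: "bdd_below (?f ` ?F)"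
  define A where "A = {1..n} \<times> {1..n} \<times> {1..int T}"
  define V where "V = {1..n} \<times> {1..int T}"
  define src :: "nat \<times> nat \<times> int \<Rightarrow> nat \<times> int" where "src = (\<lambda>(i, j, t). (i, t))"
  define dst where "dst = (\<lambda>(i, j, t). (j, t + \<tau> i j))"
  define b where "b v = real (s (fst v) (snd v))" for v
  define d where "d k = (\<lambda>(i, j, t). real (dem k i j t))" for k
  define g where "g = shortfall_cost A {1..K} d (1 / real K) (\<lambda>(i, j, t). c i j t)"
  define unc :: "flow \<Rightarrow> nat \<times> nat \<times> int \<Rightarrow> real" where "unc x = (\<lambda>(i, j, t). x i j t)" for x
  define cur :: "(nat \<times> nat \<times> int \<Rightarrow> real) \<Rightarrow> flow" where "cur y i j t = y (i, j, t)" for y i j t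
  \<comment> \<open>Completes a flow by the least feasible \<open>u\<close>.\<close>
  define lift where "lift x = (x, \<lambda>k i j t. max 0 (real (dem k i j t) - x i j t))" for x :: flow
  have cons: "flow_conservation n T \<tau> s x \<longleftrightarrow> (\<forall>v\<in>V. net_outflow A src dst (unc x) v = b v)" for x
    unfolding flow_conservation_iff_net_outflow A_def V_def src_def dst_def b_def unc_def ..
  have unc_cur: "unc (cur y) = y" for y by (simp add: unc_def cur_def)
  have lift_feas: "lift x \<in> ?F" if "flow_conservation n T \<tau> s x" for x
    using that by (auto simp: lift_def lp_feasible_def)
  have lift_obj: "?f (lift x) = g (unc x)" for x
    by (auto simp: lift_def lp_objective_eq g_def shortfall_cost_def A_def d_def unc_def
        intro!: sum.cong)
  \<comment> \<open>Any feasible \<open>u\<close> dominates the positive part of the unmet demand,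
    and the weight \<open>1 / real K\<close> is nonnegative.\<close>
  have obj_ge: "g (unc x) \<le> ?f (x, u)" if "(x, u) \<in> ?F" for x u
    unfolding lp_objective_eq g_def shortfall_cost_def A_def[symmetric]
  proof (rule sum_mono)
    fix a assume "a \<in> A"
    then show "(case a of (i, j, t) \<Rightarrow> c i j t) * unc x a +
        1 / real K * (\<Sum>k\<in>{1..K}. max 0 (d k a - unc x a))
      \<le> (case a of (i, j, t) \<Rightarrow> c i j t * x i j t + 1 / real K * (\<Sum>k\<in>{1..K}. u k i j t))"
      using that by (auto simp: A_def d_def unc_def lp_feasible_def
          intro!: divide_right_mono sum_mono)
  qed
  obtain m where m: "\<And>v. v \<in> ?F \<Longrightarrow> m \<le> ?f v" using bdd by (auto simp: bdd_below_def)
  obtain x0 where x0: "flow_conservation n T \<tau> s x0"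
    using \<open>?F \<noteq> {}\<close> by (auto simp: lp_feasible_def)
  obtain y where y: "\<forall>v\<in>V. net_outflow A src dst y v = b v" "\<And>a. a \<in> A \<Longrightarrow> y a \<in> \<int>"
    "\<And>w. (\<forall>v\<in>V. net_outflow A src dst w v = b v) \<Longrightarrow> g y \<le> g w"
    unfolding g_def
  proof (rule ex_integral_min_cost_flow)
    show "\<forall>v\<in>V. net_outflow A src dst (unc x0) v = b v" using x0 cons by simp
    fix w assume "\<forall>v\<in>V. net_outflow A src dst w v = b v"
    then have "flow_conservation n T \<tau> s (cur w)" by (simp add: cons unc_cur)
    from m[OF lift_feas[OF this]]
    show "m \<le> shortfall_cost A {1..K} d (1 / real K) (\<lambda>(i, j, t). c i j t) w"
      by (simp add: lift_obj unc_cur g_def)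
  \<comment> \<open>\<open>K \<ge> 1\<close> gives every arc a breakpoint.\<close>
  qed (use assms in \<open>auto simp: A_def b_def d_def\<close>)
  have "lift (cur y) \<in> ?F" using y(1) by (intro lift_feas) (simp add: cons unc_cur)
  moreover have "?f (lift (cur y)) \<le> ?f v" if "v \<in> ?F" for v
  proof -
    obtain x u where v: "v = (x, u)" by force
    have "g y \<le> g (unc x)" using that v by (intro y(3)) (simp add: lp_feasible_def flip: cons)
    with obj_ge[of x u] that v show ?thesis by (simp add: lift_obj unc_cur)
  qed
  ultimately have "is_arg_min ?f (\<lambda>w. w \<in> ?F) (lift (cur y))"
    by (auto simp: is_arg_min_linorder)
  moreover have "lift (cur y) \<in> integer_valued n T K"
    using y(2) by (auto simp: integer_valued_def lift_def cur_def A_def max_def)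
  ultimately show "\<exists>v\<in>integer_valued n T K. is_arg_min ?f (\<lambda>w. w \<in> ?F) v" by blast
qed

end
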